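(* Let $M$ be a smooth connected finite-dimensional manifold, $G$ a Lie group, and $\Phi:G\times M\to M$, $\Phi(g,z)=g\cdot z$, a smooth action. Let $\varphi:C^{\infty}(M,G)\to C^{\infty}(M,M)$ be the mapping defined by $\varphi(\alpha)(z)=\alpha(z)\cdot z$, and let $Z_{\mathrm{id}}=\varphi^{-1}(\mathrm{id}_M)$. Then: (1) $Z_{\mathrm{id}}$ is a subgroup of $C^{\infty}(M,G)$; (2) for $\alpha,\beta\in C^{\infty}(M,G)$, one has $\varphi(\alpha)=\varphi(\beta)$ if and only if $\alpha^{-1}\cdot\beta\in Z_{\mathrm{id}}$.
   Context: Smooth means $C^\infty$. $C^{\infty}(M,G)$ is a group under pointwise multiplication; $\alpha^{-1}\cdot\beta$ denotes the mapping $z\mapsto \alpha(z)^{-1}\beta(z)$. *)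

theory Defs
  imports "HOL-Analysis.Analysis" "HOL-Algebra.Group_Action"
begin

text \<open>
  As in \<^const>\<open>Euclidean_space\<close>, the space $R^n$ consists of the functions on the natural numbers
  that vanish from index n on. In particular n = 0 is allowed, so that discrete groups are
  zero-dimensional Lie groups.
\<close>

definition partial_deriv :: "nat \<Rightarrow> ((nat \<Rightarrow> real) \<Rightarrow> real) \<Rightarrow> (nat \<Rightarrow> real) \<Rightarrow> real" where
  "partial_deriv i f x = deriv (\<lambda>t. f (x(i := t))) (x i)"

text \<open>
  For U open in $R^n$: all partial derivatives of order at most k exist and are continuous on U.
\<close>

primrec C_k_on :: "nat \<Rightarrow> nat \<Rightarrow> (nat \<Rightarrow> real) set \<Rightarrow> ((nat \<Rightarrow> real) \<Rightarrow> real) \<Rightarrow> bool" where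
  "C_k_on n 0 U f \<longleftrightarrow> continuous_map (subtopology (Euclidean_space n) U) euclideanreal f"
| "C_k_on n (Suc k) U f \<longleftrightarrow>
     continuous_map (subtopology (Euclidean_space n) U) euclideanreal f \<and>
     (\<forall>i<n. (\<forall>x\<in>U. (\<lambda>t. f (x(i := t))) field_differentiable at (x i)) \<and>
            C_k_on n k U (partial_deriv i f))"

definition smooth_on ::
  "nat \<Rightarrow> nat \<Rightarrow> (nat \<Rightarrow> real) set \<Rightarrow> ((nat \<Rightarrow> real) \<Rightarrow> nat \<Rightarrow> real) \<Rightarrow> bool" where
  "smooth_on n m U f \<longleftrightarrow> (\<forall>j<m. \<forall>k. C_k_on n k U (\<lambda>x. f x j))"

text \<open>
  A chart is a pair of its domain and its coordinate map; the values of the coordinate map outside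
  the domain are irrelevant. The atlas need not be maximal: it represents the smooth structure
  that it generates.
\<close>

record 'a manifold =
  mdim :: nat
  mtop :: "'a topology"
  matlas :: "('a set \<times> ('a \<Rightarrow> nat \<Rightarrow> real)) set"

abbreviation points :: "'a manifold \<Rightarrow> 'a set" where
  "points M \<equiv> topspace (mtop M)"

definition smooth_manifold :: "'a manifold \<Rightarrow> bool" where
  "smooth_manifold M \<longleftrightarrow>
     Hausdorff_space (mtop M) \<and> second_countable (mtop M) \<and>
     (\<Union>(U, \<phi>)\<in>matlas M. U) = points M \<and>
     (\<forall>(U, \<phi>)\<in>matlas M.
        openin (mtop M) U \<and> openin (Euclidean_space (mdim M)) (\<phi> ` U) \<and>
        homeomorphic_map (subtopology (mtop M) U)
          (subtopology (Euclidean_space (mdim M)) (\<phi> ` U)) \<phi>) \<and>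
     (\<forall>(U, \<phi>)\<in>matlas M. \<forall>(V, \<psi>)\<in>matlas M.
        smooth_on (mdim M) (mdim M) (\<phi> ` (U \<inter> V)) (\<psi> \<circ> inv_into U \<phi>))"

definition smooth_map :: "'a manifold \<Rightarrow> 'b manifold \<Rightarrow> ('a \<Rightarrow> 'b) \<Rightarrow> bool" where
  "smooth_map M N f \<longleftrightarrow>
     continuous_map (mtop M) (mtop N) f \<and>
     (\<forall>(U, \<phi>)\<in>matlas M. \<forall>(V, \<psi>)\<in>matlas N.
        smooth_on (mdim M) (mdim N) (\<phi> ` (U \<inter> f -` V)) (\<psi> \<circ> f \<circ> inv_into U \<phi>))"

text \<open>
  The identification of a pair in $R^m \times R^n$ with a point of $R^{m+n}$.
\<close>

definition join_coords :: "nat \<Rightarrow> (nat \<Rightarrow> real) \<Rightarrow> (nat \<Rightarrow> real) \<Rightarrow> nat \<Rightarrow> real" where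
  "join_coords m x y = (\<lambda>i. if i < m then x i else y (i - m))"

definition product_manifold :: "'a manifold \<Rightarrow> 'b manifold \<Rightarrow> ('a \<times> 'b) manifold" where
  "product_manifold M N =
     \<lparr>mdim = mdim M + mdim N,
      mtop = prod_topology (mtop M) (mtop N),
      matlas = {(U \<times> V, \<lambda>(x, y). join_coords (mdim M) (\<phi> x) (\<psi> y)) | U \<phi> V \<psi>.
                 (U, \<phi>) \<in> matlas M \<and> (V, \<psi>) \<in> matlas N}\<rparr>"

definition lie_group :: "('g, 'x) monoid_scheme \<Rightarrow> 'g manifold \<Rightarrow> bool" where
  "lie_group G N \<longleftrightarrow>
     group G \<and> smooth_manifold N \<and> points N = carrier G \<and>
     smooth_map (product_manifold N N) N (\<lambda>(g, h). g \<otimes>\<^bsub>G\<^esub> h) \<and>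
     smooth_map N N (\<lambda>g. inv\<^bsub>G\<^esub> g)"

definition smooth_action ::
  "('g, 'x) monoid_scheme \<Rightarrow> 'g manifold \<Rightarrow> 'm manifold \<Rightarrow> ('g \<Rightarrow> 'm \<Rightarrow> 'm) \<Rightarrow> bool" where
  "smooth_action G N M \<Phi> \<longleftrightarrow>
     group_action G (points M) \<Phi> \<and>
     smooth_map (product_manifold N M) M (\<lambda>(g, z). \<Phi> g z)"

text \<open>
  Elements are extensional functions, so that equality of functions is equality of maps on the
  points of M.
\<close>

definition C_infinity :: "'a manifold \<Rightarrow> 'b manifold \<Rightarrow> ('a \<Rightarrow> 'b) set" where
  "C_infinity M N = {f \<in> extensional (points M). smooth_map M N f}"

definition C_infinity_group ::
  "'m manifold \<Rightarrow> ('g, 'x) monoid_scheme \<Rightarrow> 'g manifold \<Rightarrow> ('m \<Rightarrow> 'g) monoid" where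
  "C_infinity_group M G N =
     \<lparr>carrier = C_infinity M N,
      mult = (\<lambda>\<alpha> \<beta>. \<lambda>z\<in>points M. \<alpha> z \<otimes>\<^bsub>G\<^esub> \<beta> z),
      one = (\<lambda>z\<in>points M. \<one>\<^bsub>G\<^esub>)\<rparr>"

definition shift_map :: "'m manifold \<Rightarrow> ('g \<Rightarrow> 'm \<Rightarrow> 'm) \<Rightarrow> ('m \<Rightarrow> 'g) \<Rightarrow> 'm \<Rightarrow> 'm" where
  "shift_map M \<Phi> \<alpha> = (\<lambda>z\<in>points M. \<Phi> (\<alpha> z) z)"

definition Z_id :: "'m manifold \<Rightarrow> 'g manifold \<Rightarrow> ('g \<Rightarrow> 'm \<Rightarrow> 'm) \<Rightarrow> ('m \<Rightarrow> 'g) set" where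
  "Z_id M N \<Phi> = {\<alpha> \<in> C_infinity M N. shift_map M \<Phi> \<alpha> = (\<lambda>z\<in>points M. z)}"

end

theory Submission
  imports Defs
begin

text \<open>
  On points the statement is elementary. Since $g \mapsto (z \mapsto g \cdot z)$ is an action,
  $\alpha(z) \cdot z = \beta(z) \cdot z$ holds exactly when $\alpha(z)^{-1}\beta(z)$ fixes z
  (\<open>inverse_mult_fixes_iff\<close>), which is the second claim; and $Z_{id}$ is a subgroup because at each
  point it consists of the values in the stabilizer of that point, a condition closed under the
  pointwise operations.

  The substance lies in smoothness: the pointwise product and inverse of smooth maps into G, and
  the map $z \mapsto \alpha(z) \cdot z$, must again be smooth. Each of them is a composition: a
  smooth map on a product (multiplication or action) after a pairing such as
  $z \mapsto (\alpha(z), z)$, or inversion after $\alpha$. So everything rests on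
  \<open>smooth_map_compose\<close> and \<open>smooth_map_Pair\<close>.

  In charts, composition becomes the statement that $C^k$ functions of several variables are closed
  under composition (\<open>C_k_on_compose\<close>). It is proved by induction on k from the chain rule
  $\partial_i (f \circ g) = \sum_j (\partial_j f \circ g) \cdot \partial_i g_j$, whose right-hand
  side is $C^k$ by the induction hypothesis, as sums and products preserve $C^k$. The chain rule in
  turn follows from continuity of the partial derivatives, by letting the coordinates of the inner
  curve vary one at a time (\<open>has_derivative_along_coordinates\<close>).

  Passing to charts of the middle manifold of a composition requires that they cover it and are
  injective and open maps. When the middle manifold is a product, this is
  \<open>open_injective_charts_product\<close>.
\<close>

section \<open>Calculus on open subsets of Euclidean space\<close>

lemma continuous_map_Euclidean_subspace:
  assumes "openin (Euclidean_space n) U"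
  shows "continuous_map (subtopology (Euclidean_space n) U) euclideanreal f \<longleftrightarrow> continuous_on U f"
proof -
  have "{x. \<forall>i\<ge>n. x i = 0} \<inter> U = U"
    using openin_subset[OF assms] by (auto simp: topspace_Euclidean_space)
  then have "subtopology (Euclidean_space n) U = top_of_set U"
    by (simp add: Euclidean_space_def euclidean_product_topology subtopology_subtopology)
  then show ?thesis by simp
qed

lemma tendsto_coordinatewise:
  fixes h :: "'a \<Rightarrow> 'i \<Rightarrow> 'b::topological_space"
  assumes "\<And>i. ((\<lambda>t. h t i) \<longlongrightarrow> l i) F"
  shows "(h \<longlongrightarrow> l) F"
proof -
  have "limitin (product_topology (\<lambda>i. euclidean) UNIV) h l F"
    using assms by (simp add: limitin_componentwise)
  then show ?thesis by (simp add: euclidean_product_topology)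
qed

text \<open>
  A set that is open in $R^n$ need not be open in the space of all sequences, so coordinatewise
  convergence to one of its points only forces membership for sequences that stay in $R^n$.
\<close>

lemma eventually_in_open_Euclidean:
  assumes "openin (Euclidean_space n) U" and "l \<in> U"
    and "\<And>i. ((\<lambda>t. h t i) \<longlongrightarrow> l i) F"
    and "eventually (\<lambda>t. h t \<in> topspace (Euclidean_space n)) F"
  shows "eventually (\<lambda>t. h t \<in> U) F"
proof -
  have "openin (top_of_set (topspace (Euclidean_space n))) U"
    using assms(1)
    by (simp add: Euclidean_space_def euclidean_product_topology)
  then obtain T where T: "open T" "U = topspace (Euclidean_space n) \<inter> T"
    by (auto simp: openin_open)
  have "(h \<longlongrightarrow> l) F" by (rule tendsto_coordinatewise) (rule assms(3))
  then have "eventually (\<lambda>t. h t \<in> T) F"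
    using T assms(2) by (auto dest: topological_tendstoD)
  with assms(4) show ?thesis by eventually_elim (use T in auto)
qed

lemma eventually_coordinate_line_in:
  assumes "openin (Euclidean_space n) U" and "x \<in> U" and "i < n"
  shows "eventually (\<lambda>t. x(i := t) \<in> U) (nhds (x i))"
proof (rule eventually_in_open_Euclidean[OF assms(1,2)])
  show "((\<lambda>t. (x(i := t)) j) \<longlongrightarrow> x j) (nhds (x i))" for j
    by (cases "j = i") (auto simp: filterlim_ident)
  show "eventually (\<lambda>t. x(i := t) \<in> topspace (Euclidean_space n)) (nhds (x i))"
    using openin_subset[OF assms(1)] assms(2,3)
    by (auto simp: topspace_Euclidean_space)
qed

lemma partial_derivative_cong:
  assumes "openin (Euclidean_space n) U" and "x \<in> U" and "i < n"
    and "\<And>y. y \<in> U \<Longrightarrow> f y = g y"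
  shows "((\<lambda>t. f (x(i := t))) has_field_derivative d) (at (x i)) \<longleftrightarrow>
         ((\<lambda>t. g (x(i := t))) has_field_derivative d) (at (x i))"
  by (rule DERIV_cong_ev)
    (use eventually_coordinate_line_in[OF assms(1-3)] assms(4) in \<open>auto elim: eventually_mono\<close>)

text \<open>
  All partial derivatives at a point of an open set are determined by the values on that set, because
  nearby points on a coordinate line through the point stay inside it.
\<close>

lemma C_k_on_cong:
  assumes "openin (Euclidean_space n) U" and "\<And>x. x \<in> U \<Longrightarrow> f x = g x" and "C_k_on n k U f"
  shows "C_k_on n k U g"
  using assms(2,3)
proof (induction k arbitrary: f g)
  case 0
  then show ?case
    by (simp add: continuous_map_Euclidean_subspace[OF assms(1)] cong: continuous_on_cong)
next
  case (Suc k)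
  have pd: "partial_deriv i f x = partial_deriv i g x" if "i < n" "x \<in> U" for i x
    using partial_derivative_cong[OF assms(1) that(2,1), of f g] Suc.prems(1)
    by (simp add: partial_deriv_def deriv_def)
  have fd: "(\<lambda>t. g (x(i := t))) field_differentiable at (x i)" if ix: "i < n" "x \<in> U" for i x
  proof -
    obtain d where "((\<lambda>t. f (x(i := t))) has_field_derivative d) (at (x i))"
      using Suc.prems(2) ix unfolding C_k_on.simps field_differentiable_def by blast
    then show ?thesis
      using partial_derivative_cong[OF assms(1) ix(2,1), of f g] Suc.prems(1)
      unfolding field_differentiable_def by blast
  qed
  have "continuous_on U g"
    using Suc.prems
    by (simp add: continuous_map_Euclidean_subspace[OF assms(1)] cong: continuous_on_cong)
  then show ?case
    using fd pd Suc.IH[of "partial_deriv i f" "partial_deriv i g" for i] Suc.prems(2)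
    by (simp add: continuous_map_Euclidean_subspace[OF assms(1)])
qed

lemma C_k_on_imp_continuous_on:
  assumes "openin (Euclidean_space n) U" and "C_k_on n k U f"
  shows "continuous_on U f"
  using assms by (cases k) (simp_all add: continuous_map_Euclidean_subspace)

text \<open>
  Any functions that agree with the partial derivatives on U may stand in for the literal
  \<open>partial_deriv i f\<close>, so that the sum, product and chain rules can be applied directly.
\<close>

lemma C_k_on_SucI:
  assumes U: "openin (Euclidean_space n) U" and "continuous_on U f"
    and D: "\<And>i x. i < n \<Longrightarrow> x \<in> U \<Longrightarrow>
      ((\<lambda>t. f (x(i := t))) has_field_derivative D i x) (at (x i))"
    and "\<And>i. i < n \<Longrightarrow> C_k_on n k U (D i)"
  shows "C_k_on n (Suc k) U f"
proof -
  have "C_k_on n k U (partial_deriv i f)" if "i < n" for i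
    by (rule C_k_on_cong[OF U _ assms(4)[OF that]])
      (use D that in \<open>simp add: partial_deriv_def DERIV_imp_deriv[symmetric]\<close>)
  then show ?thesis
    using assms(2) D by (auto simp: continuous_map_Euclidean_subspace[OF U] field_differentiable_def)
qed

lemma C_k_on_Suc_has_partial_derivative:
  assumes "C_k_on n (Suc k) U f" and "i < n" and "x \<in> U"
  shows "((\<lambda>t. f (x(i := t))) has_field_derivative partial_deriv i f x) (at (x i))"
  using assms by (simp add: partial_deriv_def DERIV_deriv_iff_field_differentiable)

lemma C_k_on_Suc_partial_deriv:
  "C_k_on n (Suc k) U f \<Longrightarrow> i < n \<Longrightarrow> C_k_on n k U (partial_deriv i f)"
  by simp

lemma C_k_on_decrease:
  assumes "C_k_on n (Suc k) U f"
  shows "C_k_on n k U f"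
  using assms by (induction k arbitrary: f) auto

lemma C_k_on_const:
  assumes "openin (Euclidean_space n) U"
  shows "C_k_on n k U (\<lambda>x. c)"
proof (induction k arbitrary: c)
  case (Suc k)
  show ?case by (rule C_k_on_SucI[OF assms, where D = "\<lambda>i x. 0"]) (use Suc in auto)
qed simp

lemma C_k_on_add:
  assumes U: "openin (Euclidean_space n) U" and "C_k_on n k U f" and "C_k_on n k U g"
  shows "C_k_on n k U (\<lambda>x. f x + g x)"
  using assms(2,3)
proof (induction k arbitrary: f g)
  case 0
  then show ?case by (simp add: continuous_map_add)
next
  case (Suc k)
  show ?case
  proof (rule C_k_on_SucI[OF U, where D = "\<lambda>i x. partial_deriv i f x + partial_deriv i g x"])
    show "continuous_on U (\<lambda>x. f x + g x)"
      using Suc.prems C_k_on_imp_continuous_on[OF U] by (blast intro: continuous_on_add)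
    show "((\<lambda>t. f (x(i := t)) + g (x(i := t))) has_field_derivative
        partial_deriv i f x + partial_deriv i g x) (at (x i))" if "i < n" "x \<in> U" for i x
      using Suc.prems[THEN C_k_on_Suc_has_partial_derivative, OF that] by (rule DERIV_add)
    show "C_k_on n k U (\<lambda>x. partial_deriv i f x + partial_deriv i g x)" if "i < n" for i
      using Suc.prems[THEN C_k_on_Suc_partial_deriv, OF that] by (rule Suc.IH)
  qed
qed

lemma C_k_on_mult:
  assumes U: "openin (Euclidean_space n) U" and "C_k_on n k U f" and "C_k_on n k U g"
  shows "C_k_on n k U (\<lambda>x. f x * g x)"
  using assms(2,3)
proof (induction k arbitrary: f g)
  case 0
  then show ?case by (simp add: continuous_map_real_mult)
next
  case (Suc k)
  show ?case
  proof (rule C_k_on_SucI[OF U,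
        where D = "\<lambda>i x. partial_deriv i f x * g x + partial_deriv i g x * f x"])
    show "continuous_on U (\<lambda>x. f x * g x)"
      using Suc.prems C_k_on_imp_continuous_on[OF U] by (blast intro: continuous_on_mult)
    show "((\<lambda>t. f (x(i := t)) * g (x(i := t))) has_field_derivative
        partial_deriv i f x * g x + partial_deriv i g x * f x) (at (x i))" if "i < n" "x \<in> U" for i x
      using DERIV_mult[OF Suc.prems[THEN C_k_on_Suc_has_partial_derivative, OF that]] by (simp only: fun_upd_triv)
    show "C_k_on n k U (\<lambda>x. partial_deriv i f x * g x + partial_deriv i g x * f x)"
      if "i < n" for i
      using Suc.prems[THEN C_k_on_Suc_partial_deriv, OF that] Suc.prems[THEN C_k_on_decrease]
      by (intro C_k_on_add[OF U] Suc.IH)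
  qed
qed

lemma C_k_on_sum:
  assumes "openin (Euclidean_space n) U" and "finite I" and "\<And>j. j \<in> I \<Longrightarrow> C_k_on n k U (f j)"
  shows "C_k_on n k U (\<lambda>x. \<Sum>j\<in>I. f j x)"
  using assms(2,3) by (induction I) (auto intro: C_k_on_const C_k_on_add assms(1))

text \<open>
  Both continuity and partial derivatives at a point depend only on a neighbourhood, so the property
  may be checked there. This is needed because a composition of maps between manifolds is covered by
  charts of the middle manifold only locally.
\<close>

lemma C_k_on_local:
  assumes U: "openin (Euclidean_space n) U"
    and "\<And>x. x \<in> U \<Longrightarrow> \<exists>V. openin (Euclidean_space n) V \<and> x \<in> V \<and> C_k_on n k V f"
  shows "C_k_on n k U f"
  using assms(2)
proof (induction k arbitrary: f)
  case (0 f)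
  have "continuous (at x within U) f" if x: "x \<in> U" for x
  proof -
    obtain V where V: "openin (Euclidean_space n) V" "x \<in> V" "C_k_on n 0 V f"
      using 0[OF x] by blast
    have "openin (top_of_set (topspace (Euclidean_space n))) V"
      using V(1) by (simp add: Euclidean_space_def euclidean_product_topology)
    then obtain T where T: "open T" "V = topspace (Euclidean_space n) \<inter> T"
      by (auto simp: openin_open)
    have "continuous (at x within V) f"
      using C_k_on_imp_continuous_on[OF V(1,3)] V(2)
      by (simp add: continuous_on_eq_continuous_within)
    then have "continuous (at x within (U \<inter> V)) f"
      by (rule continuous_within_subset) simp
    moreover have "at x within (U \<inter> V) = at x within U"
      by (rule at_within_nhd[of x T]) (use V(2) T openin_subset[OF U] in auto)
    ultimately show ?thesis by simp
  qed
  then show ?case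
    by (simp add: continuous_map_Euclidean_subspace[OF U] continuous_on_eq_continuous_within)
next
  case (Suc k)
  show ?case
  proof (rule C_k_on_SucI[OF U])
    have "C_k_on n k U f"
      by (rule Suc.IH) (meson Suc.prems C_k_on_decrease)
    then show "continuous_on U f" by (rule C_k_on_imp_continuous_on[OF U])
    show "((\<lambda>t. f (x(i := t))) has_field_derivative partial_deriv i f x) (at (x i))"
      if ix: "i < n" "x \<in> U" for i x
    proof -
      obtain V where "C_k_on n (Suc k) V f" "x \<in> V"
        using Suc.prems[OF ix(2)] by blast
      then show ?thesis using ix(1) by (blast intro: C_k_on_Suc_has_partial_derivative)
    qed
    show "C_k_on n k U (partial_deriv i f)" if "i < n" for i
      by (rule Suc.IH) (meson Suc.prems C_k_on_Suc_partial_deriv that)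
  qed
qed

lemma C_k_on_subset:
  assumes "openin (Euclidean_space n) V" and "openin (Euclidean_space n) U" and "V \<subseteq> U"
    and "C_k_on n k U f"
  shows "C_k_on n k V f"
  by (rule C_k_on_local[OF assms(1)]) (use assms in blast)

text \<open>
  The chain rule along a curve c, with only the first j coordinates moving and the others frozen at
  their value for $t_0$. Unfreezing coordinate j gives a function of two real variables, the time and
  that coordinate. Its derivative in time is the induction hypothesis, its derivative in the
  coordinate exists nearby and is continuous, so it is differentiable as a function of two
  variables; restricting it to the graph of the j-th coordinate adds the j-th term.
\<close>

lemma has_derivative_along_coordinates:
  fixes c :: "real \<Rightarrow> nat \<Rightarrow> real"
  assumes B: "openin (Euclidean_space m) B" and cB: "c t0 \<in> B"
    and dc: "\<And>j. j < m \<Longrightarrow> ((\<lambda>t. c t j) has_field_derivative d j) (at t0)"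
    and df: "\<And>j y. j < m \<Longrightarrow> y \<in> B \<Longrightarrow>
      ((\<lambda>s. f (y(j := s))) has_field_derivative partial_deriv j f y) (at (y j))"
    and cont: "\<And>j. j < m \<Longrightarrow> continuous_on B (partial_deriv j f)"
    and "j \<le> m"
  shows "((\<lambda>t. f (\<lambda>k. if k < j then c t k else c t0 k)) has_field_derivative
      (\<Sum>k<j. partial_deriv k f (c t0) * d k)) (at t0)"
  using \<open>j \<le> m\<close>
proof (induction j)
  case 0
  then show ?case by simp
next
  case (Suc j)
  then have j: "j < m" by simp
  define y where "y t = (\<lambda>k. if k < j then c t k else c t0 k)" for t
  let ?s0 = "c t0 j"
  have IH: "((\<lambda>t. f (y t)) has_field_derivative
      (\<Sum>k<j. partial_deriv k f (c t0) * d k)) (at t0)"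
    using Suc unfolding y_def by simp
  have y0: "y t0 = c t0" by (simp add: y_def fun_eq_iff)
  have zero: "c t0 k = 0" if "k \<ge> m" for k
    using openin_subset[OF B] cB that by (auto simp: topspace_Euclidean_space)
  have lim: "((\<lambda>(t, s). ((y t)(j := s)) k) \<longlongrightarrow> c t0 k) (nhds (t0, ?s0))" for k
  proof -
    have 1: "(fst \<longlongrightarrow> t0) (nhds (t0, ?s0))" "(snd \<longlongrightarrow> ?s0) (nhds (t0, ?s0))"
      using tendsto_fst[OF filterlim_ident, of "(t0, ?s0)"] tendsto_snd[OF filterlim_ident, of "(t0, ?s0)"]
      by simp_all
    have 2: "((\<lambda>t. c t k) \<longlongrightarrow> c t0 k) (nhds t0)" if "k < j"
      using DERIV_isCont[OF dc[of k]] that j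
        by (simp add: isCont_def tendsto_at_iff_tendsto_nhds[of "\<lambda>t. c t k"])
    have "((\<lambda>p. c (fst p) k) \<longlongrightarrow> c t0 k) (nhds (t0, ?s0))" if "k < j"
      using filterlim_compose[OF 2[OF that] 1(1)] .
    with 1(2) show ?thesis
      by (cases "k = j"; cases "k < j") (simp_all add: y_def case_prod_unfold)
  qed
  \<comment> \<open>The two-variable derivative needs a product neighbourhood with a convex second factor on which
    all points stay in \<open>B\<close>.\<close>
  have "eventually (\<lambda>(t, s). (y t)(j := s) \<in> B) (nhds (t0, ?s0))"
    unfolding case_prod_unfold
    by (rule eventually_in_open_Euclidean[OF B cB])
      (use lim j zero in \<open>auto simp: case_prod_unfold topspace_Euclidean_space y_def\<close>)
  then obtain S where S: "open S" "(t0, ?s0) \<in> S" "\<And>t s. (t, s) \<in> S \<Longrightarrow> (y t)(j := s) \<in> B"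
    unfolding eventually_nhds by fast
  obtain X Y' where XY': "open X" "open Y'" "t0 \<in> X" "?s0 \<in> Y'" "X \<times> Y' \<subseteq> S"
    using S(1,2) by (auto elim!: open_prod_elim)
  obtain e where e: "e > 0" "ball ?s0 e \<subseteq> Y'"
    using XY' by (meson openE)
  define Y where "Y = ball ?s0 e"
  have inB: "(y t)(j := s) \<in> B" if "t \<in> X" "s \<in> Y" for t s
    using that S(3) XY' e unfolding Y_def by blast
  have Y: "open Y" "?s0 \<in> Y" "convex Y" using e by (auto simp: Y_def)
  define P where "P t s = partial_deriv j f ((y t)(j := s))" for t s
  have "((\<lambda>(t, s). f ((y t)(j := s))) has_derivative
      (\<lambda>(tx, ty). (\<Sum>k<j. partial_deriv k f (c t0) * d k) * tx + blinfun_mult_right (P t0 ?s0) ty))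
      (at (t0, ?s0) within X \<times> Y)"
  proof (rule has_derivative_partialsI)
    have "(y t)(j := c t0 j) = y t" for t by (auto simp: y_def)
    then show "((\<lambda>t. f ((y t)(j := c t0 j))) has_derivative
        (*) (\<Sum>k<j. partial_deriv k f (c t0) * d k)) (at t0 within X)"
      using IH by (simp add: has_field_derivative_def has_derivative_at_withinI)
    show "((\<lambda>s. f ((y t)(j := s))) has_derivative blinfun_apply (blinfun_mult_right (P t s)))
        (at s within Y)" if "t \<in> X" "s \<in> Y" for t s
      using df[OF j inB[OF that]]
      by (simp add: P_def has_field_derivative_def has_derivative_at_withinI)
    have 1: "continuous (at (c t0) within B) (partial_deriv j f)"
      using cont[OF j] cB by (simp add: continuous_on_eq_continuous_within)
    have 2: "eventually (\<lambda>p. (\<lambda>(t, s). (y t)(j := s)) p \<in> B) (at (t0, ?s0) within X \<times> Y)"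
      using inB by (auto simp: eventually_at_topological intro: exI[of _ UNIV])
    have 3: "((\<lambda>(t, s). (y t)(j := s)) \<longlongrightarrow> c t0) (at (t0, ?s0) within X \<times> Y)"
      by (rule tendsto_coordinatewise)
        (use filterlim_mono[OF lim order_refl at_within_le_nhds] in \<open>simp add: case_prod_unfold\<close>)
    from continuous_within_tendsto_compose[OF 1 2 3]
    have "((\<lambda>(t, s). P t s) \<longlongrightarrow> P t0 ?s0) (at (t0, ?s0) within X \<times> Y)"
      by (simp add: P_def y0 case_prod_unfold)
    from bounded_linear.tendsto[OF bounded_linear_blinfun_mult_right this]
    show "continuous (at (t0, ?s0) within X \<times> Y) (\<lambda>(t, s). blinfun_mult_right (P t s))"
      by (simp add: continuous_within case_prod_unfold)
  qed (use Y in auto)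
  then have H: "((\<lambda>(t, s). f ((y t)(j := s))) has_derivative
      (\<lambda>(tx, ty). (\<Sum>k<j. partial_deriv k f (c t0) * d k) * tx + P t0 ?s0 * ty)) (at (t0, ?s0))"
    using at_within_open[of "(t0, ?s0)" "X \<times> Y"] XY' Y by (simp add: open_Times)
  \<comment> \<open>Moving along this graph unfreezes coordinate \<open>j\<close>.\<close>
  have C: "((\<lambda>t. (t, c t j)) has_derivative (\<lambda>h. (h, d j * h))) (at t0)"
    using dc[OF j] unfolding has_field_derivative_def
    by (intro has_derivative_Pair has_derivative_ident)
  have "((\<lambda>t. f ((y t)(j := c t j))) has_derivative
      (\<lambda>h. (\<Sum>k<j. partial_deriv k f (c t0) * d k) * h + P t0 ?s0 * (d j * h))) (at t0)"
    using has_derivative_compose[OF C H] by simp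
  moreover have "(y t)(j := c t j) = (\<lambda>k. if k < Suc j then c t k else c t0 k)" for t
    by (auto simp: y_def)
  moreover have "(\<lambda>h. (\<Sum>k<j. partial_deriv k f (c t0) * d k) * h + P t0 ?s0 * (d j * h)) =
      (*) (\<Sum>k<Suc j. partial_deriv k f (c t0) * d k)"
    by (simp add: P_def y0 fun_eq_iff algebra_simps)
  ultimately show ?case
    by (simp only: has_field_derivative_def)
qed

text \<open>
  In the induction step the chain rule expresses the partial derivatives of the composition through
  compositions, products and sums of functions of class $C^k$.
\<close>

lemma C_k_on_compose:
  assumes A: "openin (Euclidean_space n) A" and B: "openin (Euclidean_space m) B"
    and gAB: "g ` A \<subseteq> B"
    and "\<And>j. j < m \<Longrightarrow> C_k_on n k A (\<lambda>x. g x j)"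
    and "C_k_on m k B f"
  shows "C_k_on n k A (\<lambda>x. f (g x))"
proof -
  have cont_g: "continuous_on A g" if g: "\<And>j. j < m \<Longrightarrow> C_k_on n k A (\<lambda>x. g x j)" for k
  proof (rule continuous_on_coordinatewise_then_product)
    fix j
    have "g x j = 0" if "x \<in> A" "\<not> j < m" for x
      using that gAB openin_subset[OF B] by (force simp: topspace_Euclidean_space)
    then show "continuous_on A (\<lambda>x. g x j)"
      using C_k_on_imp_continuous_on[OF A g] by (cases "j < m") (simp_all cong: continuous_on_cong)
  qed
  show ?thesis
    using assms(4,5)
  proof (induction k arbitrary: f)
    case (0 f)
    have "continuous_on A (\<lambda>x. f (g x))"
      by (rule continuous_on_compose2[OF C_k_on_imp_continuous_on[OF B 0(2)] cont_g[OF 0(1)] gAB])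
    then show ?case by (simp add: continuous_map_Euclidean_subspace[OF A])
  next
    case (Suc k)
    show ?case
    proof (rule C_k_on_SucI[OF A, where
          D = "\<lambda>i x. \<Sum>j<m. partial_deriv j f (g x) * partial_deriv i (\<lambda>y. g y j) x"])
      show "continuous_on A (\<lambda>x. f (g x))"
        by (rule continuous_on_compose2[OF C_k_on_imp_continuous_on[OF B Suc.prems(2)]
              cont_g[OF Suc.prems(1)] gAB])
      show "((\<lambda>t. f (g (x(i := t)))) has_field_derivative
          (\<Sum>j<m. partial_deriv j f (g x) * partial_deriv i (\<lambda>y. g y j) x)) (at (x i))"
        if i: "i < n" and x: "x \<in> A" for i x
      proof -
        define c where "c t = g (x(i := t))" for t
        have c0: "c (x i) = g x" by (simp add: c_def)
        have "((\<lambda>t. f (\<lambda>k. if k < m then c t k else c (x i) k)) has_field_derivative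
            (\<Sum>j<m. partial_deriv j f (c (x i)) * partial_deriv i (\<lambda>y. g y j) x)) (at (x i))"
        proof (rule has_derivative_along_coordinates[OF B])
          show "c (x i) \<in> B" using x gAB by (auto simp: c0)
          show "((\<lambda>t. c t j) has_field_derivative partial_deriv i (\<lambda>y. g y j) x) (at (x i))"
            if "j < m" for j
            unfolding c_def by (rule C_k_on_Suc_has_partial_derivative[OF Suc.prems(1)[OF that] i x])
          show "((\<lambda>s. f (y(j := s))) has_field_derivative partial_deriv j f y) (at (y j))"
            if "j < m" "y \<in> B" for j y
            by (rule C_k_on_Suc_has_partial_derivative[OF Suc.prems(2) that])
          show "continuous_on B (partial_deriv j f)" if "j < m" for j
            by (rule C_k_on_imp_continuous_on[OF B C_k_on_Suc_partial_deriv[OF Suc.prems(2) that]])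
        qed simp
        \<comment> \<open>Near \<open>x i\<close> the curve stays in \<open>B\<close>, so all its coordinates from \<open>m\<close> on vanish and the
          frozen ones agree with the moving ones.\<close>
        moreover have "eventually (\<lambda>t. f (\<lambda>k. if k < m then c t k else c (x i) k) = f (c t)) (nhds (x i))"
          using eventually_coordinate_line_in[OF A x i]
        proof eventually_elim
          case (elim t)
          then have "c t \<in> B" "c (x i) \<in> B" using x gAB by (auto simp: c_def)
          then have "c t k = 0 \<and> c (x i) k = 0" if "\<not> k < m" for k
            using openin_subset[OF B] that by (auto simp: topspace_Euclidean_space)
          then have "(\<lambda>k. if k < m then c t k else c (x i) k) = c t" by auto
          then show ?case by simp
        qed
        ultimately show ?thesis
          using DERIV_cong_ev[OF refl _ refl] unfolding c0 c_def by fastforce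
      qed
      show "C_k_on n k A (\<lambda>x. \<Sum>j<m. partial_deriv j f (g x) * partial_deriv i (\<lambda>y. g y j) x)"
        if i: "i < n" for i
      proof (rule C_k_on_sum[OF A finite_lessThan])
        fix j assume "j \<in> {..<m}"
        then have j: "j < m" by simp
        have "C_k_on n k A (\<lambda>x. partial_deriv j f (g x))"
          using Suc.prems(1)[THEN C_k_on_decrease] C_k_on_Suc_partial_deriv[OF Suc.prems(2) j]
          by (rule Suc.IH)
        then show "C_k_on n k A (\<lambda>x. partial_deriv j f (g x) * partial_deriv i (\<lambda>y. g y j) x)"
          using C_k_on_Suc_partial_deriv[OF Suc.prems(1)[OF j] i] by (rule C_k_on_mult[OF A])
      qed
    qed
  qed
qed

section \<open>Smooth maps between manifolds\<close>

lemma smooth_on_cong: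
  assumes "openin (Euclidean_space n) U" and "\<And>x. x \<in> U \<Longrightarrow> f x = g x" and "smooth_on n m U f"
  shows "smooth_on n m U g"
  unfolding smooth_on_def
proof (intro allI impI)
  fix j k assume j: "j < m"
  show "C_k_on n k U (\<lambda>x. g x j)"
    by (rule C_k_on_cong[OF assms(1), of "\<lambda>x. f x j"])
      (use j assms(2,3) in \<open>simp_all add: smooth_on_def\<close>)
qed

lemma smooth_on_local:
  assumes "openin (Euclidean_space n) U"
    and "\<And>x. x \<in> U \<Longrightarrow> \<exists>V. openin (Euclidean_space n) V \<and> x \<in> V \<and> smooth_on n m V f"
  shows "smooth_on n m U f"
  unfolding smooth_on_def
proof (intro allI impI)
  fix j k assume j: "j < m"
  show "C_k_on n k U (\<lambda>x. f x j)"
    by (rule C_k_on_local[OF assms(1)]) (use j assms(2) in \<open>unfold smooth_on_def, blast\<close>)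
qed

lemma smooth_on_subset:
  assumes "openin (Euclidean_space n) V" and "openin (Euclidean_space n) U" and "V \<subseteq> U"
    and "smooth_on n m U f"
  shows "smooth_on n m V f"
  using assms(4) unfolding smooth_on_def by (meson C_k_on_subset[OF assms(1-3)])

lemma smooth_on_compose:
  assumes "openin (Euclidean_space n) A" and "openin (Euclidean_space m) B" and "g ` A \<subseteq> B"
    and "smooth_on n m A g" and "smooth_on m p B f"
  shows "smooth_on n p A (f \<circ> g)"
  unfolding smooth_on_def
proof (intro allI impI)
  fix j k assume j: "j < p"
  have "C_k_on n k A (\<lambda>x. (\<lambda>y. f y j) (g x))"
    by (rule C_k_on_compose[OF assms(1-3)]) (use j assms(4,5) in \<open>simp_all add: smooth_on_def\<close>)
  then show "C_k_on n k A (\<lambda>x. (f \<circ> g) x j)" by simp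
qed

text \<open>
  What composition demands of the manifolds involved: around every point there are coordinates that
  can be inverted, and open sets of points correspond to open sets of coordinates, on which
  derivatives make sense.
\<close>

definition open_injective_charts :: "'a manifold \<Rightarrow> bool" where
  "open_injective_charts M \<longleftrightarrow>
     (\<Union>(U, \<phi>)\<in>matlas M. U) = points M \<and>
     (\<forall>(U, \<phi>)\<in>matlas M. openin (mtop M) U \<and> inj_on \<phi> U \<and>
        open_map (subtopology (mtop M) U) (Euclidean_space (mdim M)) \<phi>)"

lemma smooth_manifold_imp_open_injective_charts:
  assumes "smooth_manifold M"
  shows "open_injective_charts M"
proof -
  have "inj_on \<phi> U \<and> open_map (subtopology (mtop M) U) (Euclidean_space (mdim M)) \<phi>"
    if "(U, \<phi>) \<in> matlas M" for U \<phi>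
  proof -
    from that assms have U: "openin (mtop M) U" and im: "openin (Euclidean_space (mdim M)) (\<phi> ` U)"
      and h: "homeomorphic_map (subtopology (mtop M) U)
          (subtopology (Euclidean_space (mdim M)) (\<phi> ` U)) \<phi>"
      unfolding smooth_manifold_def by auto
    have "topspace (subtopology (mtop M) U) = U"
      using openin_subset[OF U] by (simp add: Int_absorb1)
    with homeomorphic_imp_injective_map[OF h] have "inj_on \<phi> U" by simp
    moreover have "open_map (subtopology (mtop M) U) (Euclidean_space (mdim M)) \<phi>"
      using homeomorphic_imp_open_map[OF h] im
      by (auto simp: open_map_def openin_open_subtopology)
    ultimately show ?thesis ..
  qed
  with assms show ?thesis
    by (auto simp: smooth_manifold_def open_injective_charts_def)
qed

context
  fixes M :: "'a manifold" and U \<phi>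
  assumes M: "open_injective_charts M" and chart: "(U, \<phi>) \<in> matlas M"
begin

lemma chart_domain_open: "openin (mtop M) U"
  using M chart by (auto simp: open_injective_charts_def)

lemma chart_inverse: "z \<in> U \<Longrightarrow> inv_into U \<phi> (\<phi> z) = z"
  using M chart by (auto simp: open_injective_charts_def)

lemma chart_image_open:
  assumes "openin (mtop M) W"
  shows "openin (Euclidean_space (mdim M)) (\<phi> ` (U \<inter> W))"
proof -
  have "openin (subtopology (mtop M) U) (U \<inter> W)"
    using assms by (simp add: openin_subtopology_Int2)
  then show ?thesis
    using M chart by (auto simp: open_injective_charts_def open_map_def)
qed

text \<open>
  These are the sets on which smoothness of a map is expressed in coordinates.
\<close>

lemma chart_preimage_open:
  assumes "continuous_map (mtop M) X f" and "openin X V"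
  shows "openin (Euclidean_space (mdim M)) (\<phi> ` (U \<inter> f -` V))"
proof -
  have "U \<inter> f -` V = U \<inter> {z \<in> points M. f z \<in> V}"
    using openin_subset[OF chart_domain_open] by auto
  then show ?thesis
    using chart_image_open[OF openin_continuous_map_preimage[OF assms]] by simp
qed

end

lemma chart_around_point:
  assumes "open_injective_charts M" and "z \<in> points M"
  obtains U \<phi> where "(U, \<phi>) \<in> matlas M" and "z \<in> U"
proof -
  have "z \<in> (\<Union>(U, \<phi>)\<in>matlas M. U)"
    using assms by (simp add: open_injective_charts_def)
  then show ?thesis by (auto intro: that)
qed

lemma smooth_map_cong:
  assumes M: "open_injective_charts M" and N: "open_injective_charts N"
    and f: "smooth_map M N f" and eq: "\<And>z. z \<in> points M \<Longrightarrow> f z = g z"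
  shows "smooth_map M N g"
  unfolding smooth_map_def
proof (intro conjI ballI; clarify?)
  have cont: "continuous_map (mtop M) (mtop N) f" using f by (simp add: smooth_map_def)
  then show "continuous_map (mtop M) (mtop N) g"
    by (rule continuous_map_eq) (rule eq)
  fix U \<phi> V \<psi> assume c: "(U, \<phi>) \<in> matlas M" "(V, \<psi>) \<in> matlas N"
  have U: "U \<subseteq> points M" using openin_subset[OF chart_domain_open[OF M c(1)]] .
  then have "U \<inter> g -` V = U \<inter> f -` V" using eq by auto
  moreover have "smooth_on (mdim M) (mdim N) (\<phi> ` (U \<inter> f -` V)) (\<psi> \<circ> g \<circ> inv_into U \<phi>)"
  proof (rule smooth_on_cong)
    show "openin (Euclidean_space (mdim M)) (\<phi> ` (U \<inter> f -` V))"
      by (rule chart_preimage_open[OF M c(1) cont chart_domain_open[OF N c(2)]])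
    show "smooth_on (mdim M) (mdim N) (\<phi> ` (U \<inter> f -` V)) (\<psi> \<circ> f \<circ> inv_into U \<phi>)"
      using f c by (auto simp: smooth_map_def)
  qed (use U eq in \<open>auto simp: chart_inverse[OF M c(1)]\<close>)
  ultimately show "smooth_on (mdim M) (mdim N) (\<phi> ` (U \<inter> g -` V)) (\<psi> \<circ> g \<circ> inv_into U \<phi>)"
    by simp
qed

text \<open>
  Near each point, insert a chart \<open>\<theta>\<close> of N around the image: in coordinates the map is
  $(\psi \circ g \circ \theta^{-1}) \circ (\theta \circ f \circ \phi^{-1})$, which is defined where
  f lands in the domain of \<open>\<theta>\<close>. These open sets cover the domain of the coordinate expression.
\<close>

lemma smooth_map_compose:
  assumes M: "open_injective_charts M" and N: "open_injective_charts N"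
    and P: "open_injective_charts P"
    and f: "smooth_map M N f" and g: "smooth_map N P g"
  shows "smooth_map M P (g \<circ> f)"
  unfolding smooth_map_def
proof (intro conjI ballI; clarify?)
  have cf: "continuous_map (mtop M) (mtop N) f" and cg: "continuous_map (mtop N) (mtop P) g"
    using f g by (auto simp: smooth_map_def)
  then show cgf: "continuous_map (mtop M) (mtop P) (g \<circ> f)" by (rule continuous_map_compose)
  fix U \<phi> V \<psi> assume c: "(U, \<phi>) \<in> matlas M" "(V, \<psi>) \<in> matlas P"
  note V = chart_domain_open[OF P c(2)]
  let ?h = "\<psi> \<circ> (g \<circ> f) \<circ> inv_into U \<phi>"
  show "smooth_on (mdim M) (mdim P) (\<phi> ` (U \<inter> (g \<circ> f) -` V)) ?h"
  proof (rule smooth_on_local)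
    show "openin (Euclidean_space (mdim M)) (\<phi> ` (U \<inter> (g \<circ> f) -` V))"
      by (rule chart_preimage_open[OF M c(1) cgf V])
    fix x assume "x \<in> \<phi> ` (U \<inter> (g \<circ> f) -` V)"
    then obtain z where z: "z \<in> U" "g (f z) \<in> V" "x = \<phi> z" by auto
    have UM: "U \<subseteq> points M" using openin_subset[OF chart_domain_open[OF M c(1)]] .
    then have "f z \<in> points N"
      using z(1) cf by (auto simp: continuous_map_def)
    then obtain W \<theta> where W: "(W, \<theta>) \<in> matlas N" "f z \<in> W"
      by (rule chart_around_point[OF N])
    note WN = chart_domain_open[OF N W(1)]
    define O' where "O' = W \<inter> {y \<in> points N. g y \<in> V}"
    have O': "openin (mtop N) O'"
      unfolding O'_def using WN openin_continuous_map_preimage[OF cg V] by (rule openin_Int)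
    have O'_eq: "O' = W \<inter> g -` V" using openin_subset[OF WN] by (auto simp: O'_def)
    define A where "A = \<phi> ` (U \<inter> f -` O')"
    define B where "B = \<theta> ` (W \<inter> g -` V)"
    have A: "openin (Euclidean_space (mdim M)) A"
      unfolding A_def by (rule chart_preimage_open[OF M c(1) cf O'])
    have B: "openin (Euclidean_space (mdim N)) B"
      unfolding B_def by (rule chart_preimage_open[OF N W(1) cg V])
    have "smooth_on (mdim M) (mdim N) A (\<theta> \<circ> f \<circ> inv_into U \<phi>)"
    proof (rule smooth_on_subset[OF A])
      show "openin (Euclidean_space (mdim M)) (\<phi> ` (U \<inter> f -` W))"
        by (rule chart_preimage_open[OF M c(1) cf WN])
      show "A \<subseteq> \<phi> ` (U \<inter> f -` W)" by (auto simp: A_def O'_eq)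
      show "smooth_on (mdim M) (mdim N) (\<phi> ` (U \<inter> f -` W)) (\<theta> \<circ> f \<circ> inv_into U \<phi>)"
        using f c(1) W(1) by (auto simp: smooth_map_def)
    qed
    moreover have "smooth_on (mdim N) (mdim P) B (\<psi> \<circ> g \<circ> inv_into W \<theta>)"
      using g c(2) W(1) by (auto simp: smooth_map_def B_def)
    moreover have "(\<theta> \<circ> f \<circ> inv_into U \<phi>) ` A \<subseteq> B"
      by (auto simp: A_def B_def O'_eq chart_inverse[OF M c(1)])
    ultimately have "smooth_on (mdim M) (mdim P) A
        ((\<psi> \<circ> g \<circ> inv_into W \<theta>) \<circ> (\<theta> \<circ> f \<circ> inv_into U \<phi>))"
      using smooth_on_compose[OF A B] by blast
    then have "smooth_on (mdim M) (mdim P) A ?h"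
      by (rule smooth_on_cong[OF A, rotated])
        (auto simp: A_def O'_eq chart_inverse[OF M c(1)] chart_inverse[OF N W(1)])
    moreover have "x \<in> A" using z W(2) by (auto simp: A_def O'_eq)
    ultimately show "\<exists>A. openin (Euclidean_space (mdim M)) A \<and> x \<in> A \<and>
        smooth_on (mdim M) (mdim P) A ?h"
      using A by blast
  qed
qed

text \<open>
  Every coordinate of the pair in a product chart is a coordinate of one of the two components, on a
  smaller open set.
\<close>

lemma smooth_map_Pair:
  assumes M: "open_injective_charts M" and N: "open_injective_charts N"
    and P: "open_injective_charts P"
    and f: "smooth_map M N f" and g: "smooth_map M P g"
  shows "smooth_map M (product_manifold N P) (\<lambda>z. (f z, g z))"
proof -
  have cf: "continuous_map (mtop M) (mtop N) f" and cg: "continuous_map (mtop M) (mtop P) g"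
    using f g by (auto simp: smooth_map_def)
  let ?p = "\<lambda>z. (f z, g z)"
  have cp: "continuous_map (mtop M) (prod_topology (mtop N) (mtop P)) ?p"
    using cf cg by (simp add: continuous_map_paired)
  have "C_k_on (mdim M) k (\<phi> ` (U \<inter> ?p -` (V \<times> W)))
      (\<lambda>x. ((\<lambda>(x, y). join_coords (mdim N) (\<psi> x) (\<theta> y)) \<circ> ?p \<circ> inv_into U \<phi>) x j)"
    if c: "(U, \<phi>) \<in> matlas M" "(V, \<psi>) \<in> matlas N" "(W, \<theta>) \<in> matlas P"
      and j: "j < mdim N + mdim P" for U \<phi> V \<psi> W \<theta> j k
  proof -
    note V = chart_domain_open[OF N c(2)] and W = chart_domain_open[OF P c(3)]
    have A: "openin (Euclidean_space (mdim M)) (\<phi> ` (U \<inter> ?p -` (V \<times> W)))"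
      by (rule chart_preimage_open[OF M c(1) cp]) (use V W in \<open>simp add: openin_prod_Times_iff\<close>)
    have "smooth_on (mdim M) (mdim N) (\<phi> ` (U \<inter> ?p -` (V \<times> W))) (\<psi> \<circ> f \<circ> inv_into U \<phi>)"
      by (rule smooth_on_subset[OF A chart_preimage_open[OF M c(1) cf V]])
        (use f c in \<open>auto simp: smooth_map_def\<close>)
    moreover
    have "smooth_on (mdim M) (mdim P) (\<phi> ` (U \<inter> ?p -` (V \<times> W))) (\<theta> \<circ> g \<circ> inv_into U \<phi>)"
      by (rule smooth_on_subset[OF A chart_preimage_open[OF M c(1) cg W]])
        (use g c in \<open>auto simp: smooth_map_def\<close>)
    ultimately show ?thesis
      using j by (cases "j < mdim N") (simp_all add: smooth_on_def join_coords_def)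
  qed
  then show ?thesis
    using cp unfolding smooth_map_def product_manifold_def smooth_on_def by auto
qed

lemma smooth_map_const:
  assumes M: "open_injective_charts M" and N: "open_injective_charts N" and c: "c \<in> points N"
  shows "smooth_map M N (\<lambda>z. c)"
proof -
  have cont: "continuous_map (mtop M) (mtop N) (\<lambda>z. c)" using c by simp
  have "C_k_on (mdim M) k (\<phi> ` (U \<inter> (\<lambda>z. c) -` V)) (\<lambda>x. \<psi> c j)"
    if "(U, \<phi>) \<in> matlas M" "(V, \<psi>) \<in> matlas N" for U \<phi> V \<psi> j k
    by (rule C_k_on_const[OF chart_preimage_open[OF M that(1) cont chart_domain_open[OF N that(2)]]])
  then show ?thesis
    using cont unfolding smooth_map_def smooth_on_def by (auto simp: comp_def)
qed

text \<open>
  In coordinates the identity is a change of charts, smooth by the compatibility of the atlas.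
\<close>

lemma smooth_map_id:
  assumes "smooth_manifold M"
  shows "smooth_map M M (\<lambda>z. z)"
proof -
  have "\<psi> \<circ> (\<lambda>z. z) \<circ> inv_into U \<phi> = \<psi> \<circ> inv_into U \<phi>" "U \<inter> (\<lambda>z. z) -` V = U \<inter> V"
    for U V :: "'a set" and \<phi> \<psi> :: "'a \<Rightarrow> nat \<Rightarrow> real" by auto
  then show ?thesis
    using assms by (simp add: smooth_map_def smooth_manifold_def)
qed

section \<open>Charts of a product\<close>

text \<open>
  A joined point can be split continuously into its two blocks of coordinates, so the image is the
  intersection of two preimages of open sets.
\<close>

lemma openin_join_coords:
  assumes X: "openin (Euclidean_space m) X" and Y: "openin (Euclidean_space n) Y"
  shows "openin (Euclidean_space (m + n)) ((\<lambda>(x, y). join_coords m x y) ` (X \<times> Y))"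
proof -
  define p where "p z = (\<lambda>i. if i < m then z i else 0)" for z :: "nat \<Rightarrow> real"
  define q where "q z = (\<lambda>i. if i < n then z (i + m) else 0)" for z :: "nat \<Rightarrow> real"
  have proj: "continuous_map (Euclidean_space (m + n)) euclideanreal (\<lambda>z. z i)" for i
    unfolding Euclidean_space_def
    by (intro continuous_map_from_subtopology continuous_map_product_projection) simp
  have cp: "continuous_map (Euclidean_space (m + n)) (Euclidean_space m) p"
    and cq: "continuous_map (Euclidean_space (m + n)) (Euclidean_space n) q"
    unfolding p_def q_def by (simp_all add: continuous_map_componentwise_Euclidean_space proj)
  have split: "p (join_coords m x y) = x" "q (join_coords m x y) = y"
    "join_coords m x y \<in> topspace (Euclidean_space (m + n))"
    if "x \<in> X" "y \<in> Y" for x y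
    using that X[THEN openin_subset] Y[THEN openin_subset]
    by (fastforce simp: p_def q_def join_coords_def topspace_Euclidean_space fun_eq_iff)+
  have join: "z = join_coords m (p z) (q z)" if "z \<in> topspace (Euclidean_space (m + n))" for z
    using that by (auto simp: p_def q_def join_coords_def topspace_Euclidean_space fun_eq_iff)
  have "(\<lambda>(x, y). join_coords m x y) ` (X \<times> Y) =
      {z \<in> topspace (Euclidean_space (m + n)). p z \<in> X} \<inter>
      {z \<in> topspace (Euclidean_space (m + n)). q z \<in> Y}"
      (is "?L = ?R")
  proof (intro equalityI subsetI)
    show "z \<in> ?R" if "z \<in> ?L" for z using that split by auto
    show "z \<in> ?L" if "z \<in> ?R" for z
      by (rule image_eqI[of _ _ "(p z, q z)"]) (use that join in auto)
  qed
  then show ?thesis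
    using openin_continuous_map_preimage[OF cp X] openin_continuous_map_preimage[OF cq Y]
    by (simp add: openin_Int)
qed

lemma join_coords_eqD:
  assumes "join_coords m x y = join_coords m x' y'"
    and "x \<in> topspace (Euclidean_space m)" and "x' \<in> topspace (Euclidean_space m)"
  shows "x = x' \<and> y = y'"
proof
  show "x = x'"
  proof
    fix i show "x i = x' i"
      using fun_cong[OF assms(1), of i] assms(2,3)
      by (cases "i < m") (auto simp: join_coords_def topspace_Euclidean_space)
  qed
  show "y = y'"
  proof
    fix i show "y i = y' i"
      using fun_cong[OF assms(1), of "i + m"] by (simp add: join_coords_def)
  qed
qed

text \<open>
  An open set in a product of chart domains is a union of open rectangles, and a product chart maps a
  rectangle to the join of two open sets.
\<close>

lemma open_injective_charts_product:
  assumes M: "open_injective_charts M" and N: "open_injective_charts N"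
  shows "open_injective_charts (product_manifold M N)"
proof -
  have cover: "(\<Union>(U, \<phi>)\<in>matlas (product_manifold M N). U) = points M \<times> points N"
  proof (intro equalityI subsetI)
    fix w assume "w \<in> (\<Union>(U, \<phi>)\<in>matlas (product_manifold M N). U)"
    then obtain U \<phi> V \<psi> where "(U, \<phi>) \<in> matlas M" "(V, \<psi>) \<in> matlas N" "w \<in> U \<times> V"
      by (auto simp: product_manifold_def)
    then show "w \<in> points M \<times> points N"
      using chart_domain_open[OF M, THEN openin_subset] chart_domain_open[OF N, THEN openin_subset]
      by blast
  next
    fix w assume "w \<in> points M \<times> points N"
    then obtain x y where w: "w = (x, y)" "x \<in> points M" "y \<in> points N" by blast
    obtain U \<phi> where "(U, \<phi>) \<in> matlas M" "x \<in> U" using chart_around_point[OF M w(2)] .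
    moreover obtain V \<psi> where "(V, \<psi>) \<in> matlas N" "y \<in> V"
      using chart_around_point[OF N w(3)] .
    ultimately have "(U \<times> V, \<lambda>(x, y). join_coords (mdim M) (\<phi> x) (\<psi> y)) \<in> matlas (product_manifold M N)"
      and "w \<in> U \<times> V"
      by (auto simp: product_manifold_def w(1))
    then show "w \<in> (\<Union>(U, \<phi>)\<in>matlas (product_manifold M N). U)" by blast
  qed
  have "openin (prod_topology (mtop M) (mtop N)) (U \<times> V)"
    and "inj_on (\<lambda>(x, y). join_coords (mdim M) (\<phi> x) (\<psi> y)) (U \<times> V)"
    and "open_map (subtopology (prod_topology (mtop M) (mtop N)) (U \<times> V))
        (Euclidean_space (mdim M + mdim N)) (\<lambda>(x, y). join_coords (mdim M) (\<phi> x) (\<psi> y))"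
      (is "open_map _ _ ?j")
    if c: "(U, \<phi>) \<in> matlas M" "(V, \<psi>) \<in> matlas N" for U \<phi> V \<psi>
  proof -
    note U = chart_domain_open[OF M c(1)] and V = chart_domain_open[OF N c(2)]
    show UV: "openin (prod_topology (mtop M) (mtop N)) (U \<times> V)"
      using U V by (simp add: openin_prod_Times_iff)
    have "\<phi> z \<in> topspace (Euclidean_space (mdim M))" if "z \<in> U" for z
      using openin_subset[OF chart_image_open[OF M c(1) U]] that by auto
    moreover have "inj_on \<phi> U" "inj_on \<psi> V"
      using M N c by (auto simp: open_injective_charts_def)
    ultimately show "inj_on ?j (U \<times> V)"
      by (auto simp: inj_on_def dest!: join_coords_eqD)
    show "open_map (subtopology (prod_topology (mtop M) (mtop N)) (U \<times> V))
        (Euclidean_space (mdim M + mdim N)) ?j"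
      unfolding open_map_def
    proof (intro allI impI)
      fix S assume "openin (subtopology (prod_topology (mtop M) (mtop N)) (U \<times> V)) S"
      then have S: "openin (prod_topology (mtop M) (mtop N)) S" "S \<subseteq> U \<times> V"
        using UV by (auto simp: openin_open_subtopology)
      show "openin (Euclidean_space (mdim M + mdim N)) (?j ` S)"
      proof (subst openin_subopen, intro ballI)
        fix w assume "w \<in> ?j ` S"
        then obtain x y where xy: "(x, y) \<in> S" "w = ?j (x, y)" by auto
        from S(1)[unfolded openin_prod_topology_alt, rule_format, OF xy(1)]
        obtain A B where AB: "openin (mtop M) A" "openin (mtop N) B" "x \<in> A" "y \<in> B" "A \<times> B \<subseteq> S"
          by - (elim exE conjE, rule that)
        have sub: "A \<subseteq> U" "B \<subseteq> V" using AB(3-5) S(2) by auto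
        have "openin (Euclidean_space (mdim M)) (\<phi> ` A)" "openin (Euclidean_space (mdim N)) (\<psi> ` B)"
          using chart_image_open[OF M c(1) AB(1)] chart_image_open[OF N c(2) AB(2)] sub
          by (simp_all add: Int_absorb1)
        from openin_join_coords[OF this]
        have "openin (Euclidean_space (mdim M + mdim N)) (?j ` (A \<times> B))"
          by (simp add: image_paired_Times[symmetric] image_image case_prod_unfold)
        moreover have "w \<in> ?j ` (A \<times> B)" "?j ` (A \<times> B) \<subseteq> ?j ` S"
          using AB xy by auto
        ultimately show "\<exists>T. openin (Euclidean_space (mdim M + mdim N)) T \<and> w \<in> T \<and> T \<subseteq> ?j ` S"
          by blast
      qed
    qed
  qed
  with cover show ?thesis
    unfolding open_injective_charts_def by (auto simp: product_manifold_def)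
qed

section \<open>The group of smooth maps and the action\<close>

lemma smooth_map_lie_mult:
  assumes "smooth_manifold M" and G: "lie_group G N"
    and "smooth_map M N \<alpha>" and "smooth_map M N \<beta>"
  shows "smooth_map M N (\<lambda>z. \<alpha> z \<otimes>\<^bsub>G\<^esub> \<beta> z)"
proof -
  have M: "open_injective_charts M" and N: "open_injective_charts N"
    using assms by (auto simp: lie_group_def intro: smooth_manifold_imp_open_injective_charts)
  have "smooth_map (product_manifold N N) N (\<lambda>(g, h). g \<otimes>\<^bsub>G\<^esub> h)"
    using G by (simp add: lie_group_def)
  from smooth_map_compose[OF M open_injective_charts_product[OF N N] N
      smooth_map_Pair[OF M N N assms(3,4)] this]
  show ?thesis by (simp add: comp_def)
qed

lemma smooth_map_lie_inverse:
  assumes "smooth_manifold M" and G: "lie_group G N" and "smooth_map M N \<alpha>"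
  shows "smooth_map M N (\<lambda>z. inv\<^bsub>G\<^esub> (\<alpha> z))"
proof -
  have M: "open_injective_charts M" and N: "open_injective_charts N"
    using assms by (auto simp: lie_group_def intro: smooth_manifold_imp_open_injective_charts)
  have "smooth_map N N (\<lambda>g. inv\<^bsub>G\<^esub> g)"
    using G by (simp add: lie_group_def)
  from smooth_map_compose[OF M N N assms(3) this] show ?thesis by (simp add: comp_def)
qed

lemma smooth_map_action:
  assumes "smooth_manifold M" and "smooth_manifold N" and \<Phi>: "smooth_action G N M \<Phi>"
    and \<alpha>: "smooth_map M N \<alpha>"
  shows "smooth_map M M (\<lambda>z. \<Phi> (\<alpha> z) z)"
proof -
  have M: "open_injective_charts M" and N: "open_injective_charts N"
    using assms by (auto intro: smooth_manifold_imp_open_injective_charts)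
  have "smooth_map (product_manifold N M) M (\<lambda>(g, z). \<Phi> g z)"
    using \<Phi> by (simp add: smooth_action_def)
  from smooth_map_compose[OF M open_injective_charts_product[OF N M] M
      smooth_map_Pair[OF M N M \<alpha> smooth_map_id[OF assms(1)]] this]
  show ?thesis by (simp add: comp_def)
qed

text \<open>
  Smoothness ignores the values outside M, so the extensional representative of a smooth map is smooth.
\<close>

lemma restrict_in_C_infinity:
  assumes "smooth_manifold M" and "smooth_manifold N" and "smooth_map M N f"
  shows "(\<lambda>z\<in>points M. f z) \<in> C_infinity M N"
  using smooth_map_cong[OF smooth_manifold_imp_open_injective_charts[OF assms(1)]
      smooth_manifold_imp_open_injective_charts[OF assms(2)] assms(3), of "restrict f (points M)"]
  by (simp add: C_infinity_def)

lemma C_infinity_value: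
  assumes "\<alpha> \<in> C_infinity M N" and "z \<in> points M"
  shows "\<alpha> z \<in> points N"
  using assms by (auto simp: C_infinity_def smooth_map_def continuous_map_def)

context
  fixes M :: "'m manifold" and G :: "('g, 'x) monoid_scheme" and N :: "'g manifold"
  assumes M: "smooth_manifold M" and G: "lie_group G N"
begin

interpretation G: group G
  using G by (simp add: lie_group_def)

lemma C_infinity_carrier: "\<alpha> \<in> C_infinity M N \<Longrightarrow> z \<in> points M \<Longrightarrow> \<alpha> z \<in> carrier G"
  using C_infinity_value[of \<alpha> M N] G by (auto simp: lie_group_def)

lemma C_infinity_mult:
  assumes "\<alpha> \<in> C_infinity M N" and "\<beta> \<in> C_infinity M N"
  shows "(\<lambda>z\<in>points M. \<alpha> z \<otimes>\<^bsub>G\<^esub> \<beta> z) \<in> C_infinity M N"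
  using assms G
  by (intro restrict_in_C_infinity[OF M] smooth_map_lie_mult[OF M G])
    (auto simp: C_infinity_def lie_group_def)

lemma C_infinity_inverse:
  assumes "\<alpha> \<in> C_infinity M N"
  shows "(\<lambda>z\<in>points M. inv\<^bsub>G\<^esub> (\<alpha> z)) \<in> C_infinity M N"
  using assms G
  by (intro restrict_in_C_infinity[OF M] smooth_map_lie_inverse[OF M G])
    (auto simp: C_infinity_def lie_group_def)

lemma C_infinity_one: "(\<lambda>z\<in>points M. \<one>\<^bsub>G\<^esub>) \<in> C_infinity M N"
  using G M
  by (intro restrict_in_C_infinity[OF M] smooth_map_const)
    (auto simp: lie_group_def intro: smooth_manifold_imp_open_injective_charts)

lemma C_infinity_left_inverse:
  assumes "\<alpha> \<in> C_infinity M N"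
  shows "(\<lambda>z\<in>points M. inv\<^bsub>G\<^esub> (\<alpha> z)) \<otimes>\<^bsub>C_infinity_group M G N\<^esub> \<alpha> = \<one>\<^bsub>C_infinity_group M G N\<^esub>"
  using C_infinity_carrier[OF assms] by (auto simp: C_infinity_group_def fun_eq_iff)

lemma group_C_infinity: "group (C_infinity_group M G N)"
proof (rule groupI)
  fix \<alpha> \<beta> \<gamma>
  assume "\<alpha> \<in> carrier (C_infinity_group M G N)" "\<beta> \<in> carrier (C_infinity_group M G N)"
    "\<gamma> \<in> carrier (C_infinity_group M G N)"
  then have "\<alpha> \<in> C_infinity M N" "\<beta> \<in> C_infinity M N" "\<gamma> \<in> C_infinity M N"
    by (simp_all add: C_infinity_group_def)
  from this[THEN C_infinity_carrier]
  show "\<alpha> \<otimes>\<^bsub>C_infinity_group M G N\<^esub> \<beta> \<otimes>\<^bsub>C_infinity_group M G N\<^esub> \<gamma> =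
      \<alpha> \<otimes>\<^bsub>C_infinity_group M G N\<^esub> (\<beta> \<otimes>\<^bsub>C_infinity_group M G N\<^esub> \<gamma>)"
    by (auto simp: C_infinity_group_def fun_eq_iff G.m_assoc)
next
  fix \<alpha> assume "\<alpha> \<in> carrier (C_infinity_group M G N)"
  then have \<alpha>: "\<alpha> \<in> C_infinity M N" by (simp add: C_infinity_group_def)
  have "(\<lambda>z\<in>points M. \<one>\<^bsub>G\<^esub> \<otimes>\<^bsub>G\<^esub> \<alpha> z) = \<alpha>"
  proof
    fix z show "(\<lambda>z\<in>points M. \<one>\<^bsub>G\<^esub> \<otimes>\<^bsub>G\<^esub> \<alpha> z) z = \<alpha> z"
      using C_infinity_carrier[OF \<alpha>] \<alpha>
      by (cases "z \<in> points M") (auto simp: C_infinity_def extensional_def)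
  qed
  then show "\<one>\<^bsub>C_infinity_group M G N\<^esub> \<otimes>\<^bsub>C_infinity_group M G N\<^esub> \<alpha> = \<alpha>"
    by (simp add: C_infinity_group_def cong: restrict_cong)
  show "\<exists>\<beta>\<in>carrier (C_infinity_group M G N).
      \<beta> \<otimes>\<^bsub>C_infinity_group M G N\<^esub> \<alpha> = \<one>\<^bsub>C_infinity_group M G N\<^esub>"
    by (rule bexI[where x = "\<lambda>z\<in>points M. inv\<^bsub>G\<^esub> (\<alpha> z)"], rule C_infinity_left_inverse[OF \<alpha>])
      (simp add: C_infinity_group_def C_infinity_inverse[OF \<alpha>])
qed (simp_all add: C_infinity_group_def C_infinity_mult C_infinity_one)

lemma inv_C_infinity:
  assumes "\<alpha> \<in> C_infinity M N"
  shows "inv\<^bsub>C_infinity_group M G N\<^esub> \<alpha> = (\<lambda>z\<in>points M. inv\<^bsub>G\<^esub> (\<alpha> z))"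
  by (rule group.inv_equality[OF group_C_infinity C_infinity_left_inverse[OF assms]])
    (use assms C_infinity_inverse[OF assms] in \<open>simp_all add: C_infinity_group_def\<close>)

end

lemma Z_id_iff:
  "\<alpha> \<in> Z_id M N \<Phi> \<longleftrightarrow> \<alpha> \<in> C_infinity M N \<and> (\<forall>z\<in>points M. \<Phi> (\<alpha> z) z = z)"
  by (auto simp: Z_id_def shift_map_def fun_eq_iff restrict_def)

text \<open>
  The pointwise content of the second claim: g and h move x to the same point exactly when
  \<open>inv g \<otimes> h\<close> is in the stabilizer of x.
\<close>

lemma (in group_action) inverse_mult_fixes_iff:
  assumes "g \<in> carrier G" and "h \<in> carrier G" and "x \<in> E"
  shows "\<phi> (inv g \<otimes> h) x = x \<longleftrightarrow> \<phi> g x = \<phi> h x"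
proof -
  interpret group G using group_hom by (simp add: group_hom_def)
  have hx: "\<phi> h x \<in> E" using element_image assms(2,3) by blast
  have "\<phi> (inv g \<otimes> h) x = \<phi> (inv g) (\<phi> h x)"
    using assms by (simp add: composition_rule)
  moreover have "\<phi> (inv g) (\<phi> g x) = x"
    using orbit_sym_aux[OF assms(1,3) refl] .
  moreover have "\<phi> g (\<phi> (inv g) (\<phi> h x)) = \<phi> h x"
    using orbit_sym_aux[OF inv_closed[OF assms(1)] hx refl] assms(1) by simp
  ultimately show ?thesis by metis
qed

theorem proposition2p3:
  fixes M :: "'m manifold" and G :: "'g monoid" and N :: "'g manifold"
    and \<Phi> :: "'g \<Rightarrow> 'm \<Rightarrow> 'm"
  assumes "smooth_manifold M" and "connected_space (mtop M)"
    and "lie_group G N"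
    and "smooth_action G N M \<Phi>"
  shows "group (C_infinity_group M G N) \<and>
    shift_map M \<Phi> \<in> C_infinity M N \<rightarrow> C_infinity M M \<and>
    subgroup (Z_id M N \<Phi>) (C_infinity_group M G N) \<and>
    (\<forall>\<alpha>\<in>C_infinity M N. \<forall>\<beta>\<in>C_infinity M N.
      shift_map M \<Phi> \<alpha> = shift_map M \<Phi> \<beta> \<longleftrightarrow>
      (\<lambda>z\<in>points M. inv\<^bsub>G\<^esub> (\<alpha> z) \<otimes>\<^bsub>G\<^esub> \<beta> z) \<in> Z_id M N \<Phi>)"
proof (intro conjI ballI)
  note M = assms(1) and G = assms(3)
  have N: "smooth_manifold N" and "group G" using G by (auto simp: lie_group_def)
  interpret G: group G by fact
  interpret group_action G "points M" \<Phi> using assms(4) by (simp add: smooth_action_def)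
  note value_G = C_infinity_carrier[OF M G]
  show "group (C_infinity_group M G N)" by (rule group_C_infinity[OF M G])
  show "shift_map M \<Phi> \<in> C_infinity M N \<rightarrow> C_infinity M M"
    unfolding shift_map_def
    by (intro Pi_I restrict_in_C_infinity[OF M M] smooth_map_action[OF M N assms(4)])
      (simp add: C_infinity_def)
  show "subgroup (Z_id M N \<Phi>) (C_infinity_group M G N)"
  proof
    show "Z_id M N \<Phi> \<subseteq> carrier (C_infinity_group M G N)"
      by (auto simp: Z_id_def C_infinity_group_def)
    show "\<one>\<^bsub>C_infinity_group M G N\<^esub> \<in> Z_id M N \<Phi>"
      using C_infinity_one[OF M G] fun_cong[OF id_eq_one]
      by (auto simp: Z_id_iff C_infinity_group_def restrict_def split: if_splits) metis
  next
    fix \<alpha> \<beta> assume \<alpha>: "\<alpha> \<in> Z_id M N \<Phi>" and \<beta>: "\<beta> \<in> Z_id M N \<Phi>"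
    then show "\<alpha> \<otimes>\<^bsub>C_infinity_group M G N\<^esub> \<beta> \<in> Z_id M N \<Phi>"
      using C_infinity_mult[OF M G]
      by (auto simp: Z_id_iff C_infinity_group_def composition_rule value_G)
  next
    fix \<alpha> assume "\<alpha> \<in> Z_id M N \<Phi>"
    then show "inv\<^bsub>C_infinity_group M G N\<^esub> \<alpha> \<in> Z_id M N \<Phi>"
      using C_infinity_inverse[OF M G]
      by (auto simp: Z_id_iff inv_C_infinity[OF M G] value_G intro!: orbit_sym_aux)
  qed
next
  note M = assms(1) and G = assms(3)
  interpret group_action G "points M" \<Phi> using assms(4) by (simp add: smooth_action_def)
  fix \<alpha> \<beta> assume \<alpha>: "\<alpha> \<in> C_infinity M N" and \<beta>: "\<beta> \<in> C_infinity M N"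
  let ?q = "\<lambda>z\<in>points M. inv\<^bsub>G\<^esub> (\<alpha> z) \<otimes>\<^bsub>G\<^esub> \<beta> z"
  have "?q = (\<lambda>z\<in>points M. (\<lambda>z\<in>points M. inv\<^bsub>G\<^esub> (\<alpha> z)) z \<otimes>\<^bsub>G\<^esub> \<beta> z)"
    by (auto simp: fun_eq_iff)
  then have "?q \<in> C_infinity M N"
    using C_infinity_mult[OF M G C_infinity_inverse[OF M G \<alpha>] \<beta>] by simp
  then have "?q \<in> Z_id M N \<Phi> \<longleftrightarrow> (\<forall>z\<in>points M. \<Phi> (\<alpha> z) z = \<Phi> (\<beta> z) z)"
    using C_infinity_carrier[OF M G \<alpha>] C_infinity_carrier[OF M G \<beta>]
    by (simp add: Z_id_iff inverse_mult_fixes_iff)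
  also have "\<dots> \<longleftrightarrow> shift_map M \<Phi> \<alpha> = shift_map M \<Phi> \<beta>"
    by (auto simp: shift_map_def fun_eq_iff restrict_def)
  finally show "shift_map M \<Phi> \<alpha> = shift_map M \<Phi> \<beta> \<longleftrightarrow> ?q \<in> Z_id M N \<Phi>" by simp
qed

end
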